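(* Let $M$ be the monoid defined by the monoid presentation $\langle A\mid R\rangle$, let $\rho$ be a right congruence on $M$ with word graph $\Gamma=(V,E)$, and let $\theta:A^*\to M$ be the natural homomorphism with $\ker(\theta)=R^{\#}$. Then $\rho$ is a non-trivial right Rees congruence if and only if the following conditions hold: (i) there exists a unique non-trivial sink $\omega\in V$; (ii) if $(\alpha,a,\beta)\in E$ and $\beta\neq\omega$, then $(w_\alpha a)\theta=(w_\beta)\theta$.
   Context: Functions are written to the right of their arguments. $A=\{a_0<\dots<a_{k-1}\}$ is a finite linearly ordered alphabet, $A^*$ is the free monoid on $A$ with identity the empty word $\varepsilon$, and $R\subseteq A^*\times A^*$. $R^{\#}$ is the least 2-sided congruence on $A^*$ containing $R$; the monoid defined by $\langle A\mid R\rangle$ is $M\cong A^*/R^{\#}$, and $\theta:A^*\to M$ is the natural surjective homomorphism with $\ker(\theta)=R^{\#}$. For $T\subseteq A^*\times A^*$ write $(T)\theta=\{((u)\theta,(v)\theta): (u,v)\in T\}$. A right congruence on $M$ is an equivalence relation $\rho$ with $(xs,ys)\in\rho$ for all $(x,y)\in\rho$, $s\in M$. For a right ideal $I$ of $M$, the right Rees congruence of $I$ is $\rho_I=\{(x,y)\in M\times M: x=y\text{ or }x,y\in I\}$; a right congruence is non-trivial if it is not equal to $\Delta_M=\{(m,m):m\in M\}$. A word graph over $A$ is a digraph $\Gamma=(V,E)$ with $E\subseteq V\times A\times V$; an edge $(\alpha,a,\beta)$ has source $\alpha$, label $a$, target $\beta$. It is complete (respectively deterministic) if for every node $\alpha$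 and every $a\in A$ there is at least (respectively at most) one edge with source $\alpha$ and label $a$. A path is labelled by the product of the labels of its edges; the empty path at any node is labelled by $\varepsilon$. Write $\alpha\cdot u=\beta$ if $u\in A^*$ labels a path from $\alpha$ to $\beta$ (an $(\alpha,\beta)$-path), and $\alpha\cdot u=\bot$ (undefined) if $u$ labels no path with source $\alpha$. The path relation is $(\alpha)\pi_\Gamma=\{(u,v):\alpha\cdot u\neq\bot,\ \alpha\cdot u=\alpha\cdot v\}$. $\Gamma$ is compatible with $R$ if for all $(u,v)\in R$ and $\alpha\in V$, $\alpha\cdot u=\alpha\cdot v$ whenever both are $\neq\bot$. The short-lex order on $A^*$: $u<v$ if $|u|<|v|$, or $|u|=|v|$ and $u$ is strictly lexicographically smaller than $v$. For a node $\alpha$ reachable from $0$, $w_\alpha$ is the short-lex least word labelling a $(0,\alpha)$-path. A complete word graph $\Gamma=(V,E)$ is standard if $V=\{0,1,\ldots,|V|-1\}$ (meaning $\{0,1,2,\ldots\}$ if $V$ is infinite), $\Gamma$ is deterministic, every node is reachable from $0$, and for all $\alpha,\beta\in V$: $\alpha<\beta$ if and only if $w_\alpha<w_\beta$. The word graph of a right congruence $\rho$ on $M$ is the unique standard complete word graph $\Gamma$ over $A$ compatible with $R$ such that $\rho=((0)\pi_\Gamma)\theta$. A node $\omega\in V$ is a sink if $(\omega,a,\omega)\in E$ for all $a\in A$. A sink $\omega$ is non-trivial if there exists an edge $(\alpha,a,\omega)\in E$ such that $(w_\alpha a)\theta\neq(w_\omega)\theta$. *)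

theory Defs
  imports "HOL-Algebra.Group" "HOL-Library.List_Lenlexorder"
begin

text \<open>
  The alphabet is a finite set \<open>A\<close> of elements of a linearly ordered type and \<open>A\<^sup>*\<close> is
  \<open>lists A\<close>, so that the empty alphabet is covered as well. The theory
  \<open>List_Lenlexorder\<close> makes \<open><\<close> on words the short-lex order.
\<close>

definition free_monoid :: "'a set \<Rightarrow> 'a list monoid" where
  "free_monoid A = \<lparr>carrier = lists A, monoid.mult = (@), one = []\<rparr>"

definition right_congruence :: "('m, 'z) monoid_scheme \<Rightarrow> ('m \<times> 'm) set \<Rightarrow> bool" where
  "right_congruence M \<rho> \<longleftrightarrow>
     equiv (carrier M) \<rho> \<and>
     (\<forall>(x, y) \<in> \<rho>. \<forall>s \<in> carrier M. (x \<otimes>\<^bsub>M\<^esub> s, y \<otimes>\<^bsub>M\<^esub> s) \<in> \<rho>)"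

definition left_congruence :: "('m, 'z) monoid_scheme \<Rightarrow> ('m \<times> 'm) set \<Rightarrow> bool" where
  "left_congruence M \<rho> \<longleftrightarrow>
     equiv (carrier M) \<rho> \<and>
     (\<forall>(x, y) \<in> \<rho>. \<forall>s \<in> carrier M. (s \<otimes>\<^bsub>M\<^esub> x, s \<otimes>\<^bsub>M\<^esub> y) \<in> \<rho>)"

definition two_sided_congruence :: "('m, 'z) monoid_scheme \<Rightarrow> ('m \<times> 'm) set \<Rightarrow> bool" where
  "two_sided_congruence M \<rho> \<longleftrightarrow> left_congruence M \<rho> \<and> right_congruence M \<rho>"

definition presentation_congruence ::
    "'a set \<Rightarrow> ('a list \<times> 'a list) set \<Rightarrow> ('a list \<times> 'a list) set" where
  "presentation_congruence A R = \<Inter> {\<sigma>. two_sided_congruence (free_monoid A) \<sigma> \<and> R \<subseteq> \<sigma>}"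

text \<open>
  Only \<open>M \<cong> A\<^sup>*/R\<^sup>#\<close> is required, so \<open>M\<close> is any monoid that comes with a surjective
  homomorphism \<open>\<theta>\<close> from \<open>A\<^sup>*\<close> with kernel \<open>R\<^sup>#\<close>. The homomorphisms in \<open>hom\<close> need not
  preserve the identity, whence the separate condition.
\<close>

definition monoid_defined_by ::
    "'a set \<Rightarrow> ('a list \<times> 'a list) set \<Rightarrow> ('m, 'z) monoid_scheme \<Rightarrow> ('a list \<Rightarrow> 'm) \<Rightarrow> bool" where
  "monoid_defined_by A R M \<theta> \<longleftrightarrow>
     monoid M \<and>
     \<theta> \<in> hom (free_monoid A) M \<and> \<theta> [] = \<one>\<^bsub>M\<^esub> \<and>
     \<theta> ` lists A = carrier M \<and>
     {(u, v) \<in> lists A \<times> lists A. \<theta> u = \<theta> v} = presentation_congruence A R"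

definition right_ideal :: "('m, 'z) monoid_scheme \<Rightarrow> 'm set \<Rightarrow> bool" where
  "right_ideal M I \<longleftrightarrow>
     I \<subseteq> carrier M \<and> (\<forall>x \<in> I. \<forall>s \<in> carrier M. x \<otimes>\<^bsub>M\<^esub> s \<in> I)"

definition right_Rees_congruence :: "('m, 'z) monoid_scheme \<Rightarrow> 'm set \<Rightarrow> ('m \<times> 'm) set" where
  "right_Rees_congruence M I =
     {(x, y) \<in> carrier M \<times> carrier M. x = y \<or> (x \<in> I \<and> y \<in> I)}"

definition nontrivial_right_Rees_congruence ::
    "('m, 'z) monoid_scheme \<Rightarrow> ('m \<times> 'm) set \<Rightarrow> bool" where
  "nontrivial_right_Rees_congruence M \<rho> \<longleftrightarrow>
     (\<exists>I. right_ideal M I \<and> \<rho> = right_Rees_congruence M I) \<and> \<rho> \<noteq> Id_on (carrier M)"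

record ('v, 'a) word_graph =
  nodes :: "'v set"
  edges :: "('v \<times> 'a \<times> 'v) set"

definition word_graph_over :: "'a set \<Rightarrow> ('v, 'a) word_graph \<Rightarrow> bool" where
  "word_graph_over A \<Gamma> \<longleftrightarrow> edges \<Gamma> \<subseteq> nodes \<Gamma> \<times> A \<times> nodes \<Gamma>"

definition complete_graph :: "'a set \<Rightarrow> ('v, 'a) word_graph \<Rightarrow> bool" where
  "complete_graph A \<Gamma> \<longleftrightarrow> (\<forall>\<alpha> \<in> nodes \<Gamma>. \<forall>a \<in> A. \<exists>\<beta>. (\<alpha>, a, \<beta>) \<in> edges \<Gamma>)"

definition deterministic_graph :: "'a set \<Rightarrow> ('v, 'a) word_graph \<Rightarrow> bool" where
  "deterministic_graph A \<Gamma> \<longleftrightarrow>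
     (\<forall>\<alpha> \<in> nodes \<Gamma>. \<forall>a \<in> A. \<forall>\<beta> \<gamma>. (\<alpha>, a, \<beta>) \<in> edges \<Gamma> \<and> (\<alpha>, a, \<gamma>) \<in> edges \<Gamma> \<longrightarrow> \<beta> = \<gamma>)"

text \<open>\<open>path \<Gamma> \<alpha> u \<beta>\<close> is the relation \<open>\<alpha> \<cdot> u = \<beta>\<close>; \<open>\<alpha> \<cdot> u \<noteq> \<bottom>\<close> is \<open>\<exists>\<beta>. path \<Gamma> \<alpha> u \<beta>\<close>.\<close>

inductive path :: "('v, 'a) word_graph \<Rightarrow> 'v \<Rightarrow> 'a list \<Rightarrow> 'v \<Rightarrow> bool" for \<Gamma> where
  empty_path: "\<alpha> \<in> nodes \<Gamma> \<Longrightarrow> path \<Gamma> \<alpha> [] \<alpha>"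
| edge_path: "(\<alpha>, a, \<beta>) \<in> edges \<Gamma> \<Longrightarrow> path \<Gamma> \<beta> u \<gamma> \<Longrightarrow> path \<Gamma> \<alpha> (a # u) \<gamma>"

definition path_relation :: "('v, 'a) word_graph \<Rightarrow> 'v \<Rightarrow> ('a list \<times> 'a list) set" where
  "path_relation \<Gamma> \<alpha> = {(u, v). \<exists>\<beta>. path \<Gamma> \<alpha> u \<beta> \<and> path \<Gamma> \<alpha> v \<beta>}"

definition compatible_graph :: "('a list \<times> 'a list) set \<Rightarrow> ('v, 'a) word_graph \<Rightarrow> bool" where
  "compatible_graph R \<Gamma> \<longleftrightarrow>
     (\<forall>(u, v) \<in> R. \<forall>\<alpha> \<in> nodes \<Gamma>. \<forall>\<beta> \<gamma>. path \<Gamma> \<alpha> u \<beta> \<and> path \<Gamma> \<alpha> v \<gamma> \<longrightarrow> \<beta> = \<gamma>)"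

text \<open>
  The word \<open>w\<^sub>\<alpha>\<close>. For nodes reachable from \<open>0\<close> and a finite alphabet, the short-lex least word
  exists.
\<close>

definition least_word :: "(nat, 'a::linorder) word_graph \<Rightarrow> nat \<Rightarrow> 'a list" where
  "least_word \<Gamma> \<alpha> = (LEAST w. path \<Gamma> 0 w \<alpha>)"

definition standard_graph :: "'a::linorder set \<Rightarrow> (nat, 'a) word_graph \<Rightarrow> bool" where
  "standard_graph A \<Gamma> \<longleftrightarrow>
     complete_graph A \<Gamma> \<and>
     nodes \<Gamma> = (if finite (nodes \<Gamma>) then {..<card (nodes \<Gamma>)} else UNIV) \<and>
     deterministic_graph A \<Gamma> \<and>
     (\<forall>\<alpha> \<in> nodes \<Gamma>. \<exists>w. path \<Gamma> 0 w \<alpha>) \<and>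
     (\<forall>\<alpha> \<in> nodes \<Gamma>. \<forall>\<beta> \<in> nodes \<Gamma>. \<alpha> < \<beta> \<longleftrightarrow> least_word \<Gamma> \<alpha> < least_word \<Gamma> \<beta>)"

definition word_graph_of ::
    "'a::linorder set \<Rightarrow> ('a list \<times> 'a list) set \<Rightarrow> ('a list \<Rightarrow> 'm) \<Rightarrow> ('m \<times> 'm) set \<Rightarrow>
     (nat, 'a) word_graph \<Rightarrow> bool" where
  "word_graph_of A R \<theta> \<rho> \<Gamma> \<longleftrightarrow>
     word_graph_over A \<Gamma> \<and> standard_graph A \<Gamma> \<and> compatible_graph R \<Gamma> \<and>
     \<rho> = map_prod \<theta> \<theta> ` path_relation \<Gamma> 0"

definition sink :: "'a set \<Rightarrow> ('v, 'a) word_graph \<Rightarrow> 'v \<Rightarrow> bool" where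
  "sink A \<Gamma> \<omega> \<longleftrightarrow> \<omega> \<in> nodes \<Gamma> \<and> (\<forall>a \<in> A. (\<omega>, a, \<omega>) \<in> edges \<Gamma>)"

definition nontrivial_sink ::
    "'a::linorder set \<Rightarrow> ('a list \<Rightarrow> 'm) \<Rightarrow> (nat, 'a) word_graph \<Rightarrow> nat \<Rightarrow> bool" where
  "nontrivial_sink A \<theta> \<Gamma> \<omega> \<longleftrightarrow>
     sink A \<Gamma> \<omega> \<and>
     (\<exists>\<alpha> a. (\<alpha>, a, \<omega>) \<in> edges \<Gamma> \<and> \<theta> (least_word \<Gamma> \<alpha> @ [a]) \<noteq> \<theta> (least_word \<Gamma> \<omega>))"

end

theory Submission
  imports Defs
begin

text \<open>
  In the word graph of \<open>\<rho>\<close> every word \<open>u\<close> leads from \<open>0\<close> to exactly one node, and because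
  the graph is compatible with \<open>R\<close> this node depends only on \<open>\<theta> u\<close>. The nodes are therefore
  the \<open>\<rho>\<close>-classes, and \<open>\<rho>\<close> relates \<open>\<theta> u\<close> to \<open>\<theta> v\<close> exactly when \<open>u\<close> and \<open>v\<close> lead to the
  same node (\<open>related_iff_same_node\<close>).

  A right Rees congruence is one whose classes are singletons, except for at most one class,
  which is a right ideal. That a class \<open>\<omega>\<close> is a right ideal says that \<open>\<omega>\<close> is a sink. That the
  class \<open>\<beta>\<close> is a singleton says that \<open>\<theta> u = \<theta> w\<^sub>\<beta>\<close> for all words \<open>u\<close> leading to \<open>\<beta>\<close>; by
  induction on \<open>u\<close> this only has to be tested on the words \<open>w\<^sub>\<alpha> a\<close> for edges \<open>(\<alpha>, a, \<beta>)\<close>, as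
  long as the same test succeeds on all nodes from which \<open>\<beta>\<close> can be reached
  (\<open>class_is_singleton\<close>). Since nothing except \<open>\<omega>\<close> can be reached from a sink \<open>\<omega>\<close>, the test
  on all edges that do not end at \<open>\<omega>\<close> settles all the classes other than \<open>\<omega>\<close>. Applied to all
  edges, it detects the trivial congruence, which is why in the non-trivial case
  some edge into the sink has to fail it.
\<close>

section \<open>Paths in word graphs\<close>

lemma path_over:
  assumes "path \<Gamma> \<alpha> u \<beta>" and "word_graph_over A \<Gamma>"
  shows "\<alpha> \<in> nodes \<Gamma>" and "u \<in> lists A" and "\<beta> \<in> nodes \<Gamma>"
  using assms by (induction rule: path.induct) (auto simp: word_graph_over_def)

lemma path_Nil_iff: "path \<Gamma> \<alpha> [] \<beta> \<longleftrightarrow> \<alpha> = \<beta> \<and> \<alpha> \<in> nodes \<Gamma>"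
  by (subst path.simps) auto

lemma path_Cons_iff:
  "path \<Gamma> \<alpha> (a # u) \<gamma> \<longleftrightarrow> (\<exists>\<beta>. (\<alpha>, a, \<beta>) \<in> edges \<Gamma> \<and> path \<Gamma> \<beta> u \<gamma>)"
  by (subst path.simps) auto

lemma path_append_iff:
  assumes "word_graph_over A \<Gamma>"
  shows "path \<Gamma> \<alpha> (u @ v) \<gamma> \<longleftrightarrow> (\<exists>\<beta>. path \<Gamma> \<alpha> u \<beta> \<and> path \<Gamma> \<beta> v \<gamma>)"
proof (induction u arbitrary: \<alpha>)
  case Nil
  show ?case using path_over(1)[OF _ assms] by (auto simp: path_Nil_iff)
next
  case (Cons a u)
  then show ?case by (auto simp: path_Cons_iff)
qed

lemma path_snoc_iff:
  assumes "word_graph_over A \<Gamma>"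
  shows "path \<Gamma> \<alpha> (u @ [a]) \<gamma> \<longleftrightarrow> (\<exists>\<beta>. path \<Gamma> \<alpha> u \<beta> \<and> (\<beta>, a, \<gamma>) \<in> edges \<Gamma>)"
  using assms unfolding path_append_iff[OF assms] path_Cons_iff path_Nil_iff
  by (auto simp: word_graph_over_def)

lemma path_unique:
  assumes "word_graph_over A \<Gamma>" and "deterministic_graph A \<Gamma>"
    and "path \<Gamma> \<alpha> u \<beta>" and "path \<Gamma> \<alpha> u \<gamma>"
  shows "\<beta> = \<gamma>"
  using assms(3,4)
proof (induction rule: path.induct)
  case (empty_path \<alpha>)
  then show ?case by (simp add: path_Nil_iff)
next
  case (edge_path \<alpha> a \<beta> u \<delta>)
  from edge_path.prems obtain \<beta>' where \<beta>': "(\<alpha>, a, \<beta>') \<in> edges \<Gamma>" "path \<Gamma> \<beta>' u \<gamma>"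
    by (auto simp: path_Cons_iff)
  have "\<beta>' = \<beta>"
    using assms(1,2) edge_path.hyps(1) \<beta>'(1)
    unfolding word_graph_over_def deterministic_graph_def by blast
  then show ?case using edge_path.IH \<beta>'(2) by simp
qed

lemma path_exists:
  assumes "word_graph_over A \<Gamma>" and "complete_graph A \<Gamma>" and "u \<in> lists A"
    and "\<alpha> \<in> nodes \<Gamma>"
  shows "\<exists>\<beta>. path \<Gamma> \<alpha> u \<beta>"
  using assms(3,4)
proof (induction u arbitrary: \<alpha>)
  case Nil
  then show ?case by (auto simp: path_Nil_iff)
next
  case (Cons a u)
  then obtain \<beta> where \<beta>: "(\<alpha>, a, \<beta>) \<in> edges \<Gamma>"
    using assms(2) unfolding complete_graph_def by (metis Cons_in_lists_iff)
  then have "\<beta> \<in> nodes \<Gamma>" using assms(1) by (auto simp: word_graph_over_def)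
  then obtain \<gamma> where "path \<Gamma> \<beta> u \<gamma>" using Cons by auto
  then show ?case using \<beta> by (auto simp: path_Cons_iff)
qed

lemma path_from_sink:
  assumes "word_graph_over A \<Gamma>" and "deterministic_graph A \<Gamma>" and "sink A \<Gamma> \<omega>"
    and "path \<Gamma> \<omega> u \<beta>"
  shows "\<beta> = \<omega>"
  using assms(4)
proof (induction u)
  case Nil
  then show ?case by (simp add: path_Nil_iff)
next
  case (Cons a u)
  then obtain \<gamma> where \<gamma>: "(\<omega>, a, \<gamma>) \<in> edges \<Gamma>" "path \<Gamma> \<gamma> u \<beta>"
    by (auto simp: path_Cons_iff)
  have "\<gamma> = \<omega>"
    using assms(1-3) \<gamma>(1)
    unfolding word_graph_over_def deterministic_graph_def sink_def by blast
  then show ?case using Cons.IH \<gamma>(2) by simp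
qed

text \<open>
  The short-lex order on all words over a linear order need not be a well-order, but over a
  finite alphabet only finitely many words are no longer than a given one.
\<close>

lemma path_least_word:
  assumes "finite A" and "word_graph_over A \<Gamma>" and "path \<Gamma> 0 w \<alpha>"
  shows "path \<Gamma> 0 (least_word \<Gamma> \<alpha>) \<alpha>"
proof -
  let ?S = "{v \<in> {xs. set xs \<subseteq> A \<and> length xs \<le> length w}. path \<Gamma> 0 v \<alpha>}"
  have over: "set v \<subseteq> A" if "path \<Gamma> 0 v \<alpha>" for v
    using path_over(2)[OF that assms(2)] by auto
  have fin: "finite ?S" using finite_lists_length_le[OF assms(1)] by (rule rev_finite_subset) blast
  have w: "w \<in> ?S" using assms(3) over by auto
  have m: "Min ?S \<in> ?S" using Min_in[OF fin] w by blast
  have "Min ?S \<le> v" if v: "path \<Gamma> 0 v \<alpha>" for v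
  proof (cases "length v \<le> length w")
    case True
    then show ?thesis using Min_le[OF fin] v over by simp
  next
    case False
    then have "w < v" by (simp add: list_less_def lenlex_conv)
    then show ?thesis using Min_le[OF fin w] by simp
  qed
  then have "least_word \<Gamma> \<alpha> = Min ?S"
    using m unfolding least_word_def by (intro Least_equality) auto
  then show ?thesis using m by simp
qed

lemma least_word_0: "least_word \<Gamma> 0 = []" if "0 \<in> nodes \<Gamma>"
  unfolding least_word_def
  using that by (intro Least_equality) (auto simp: path_Nil_iff)

section \<open>Nodes of the word graph as congruence classes\<close>

locale right_congruence_word_graph =
  fixes A :: "'a::linorder set"
    and R :: "('a list \<times> 'a list) set"
    and M :: "('m, 'z) monoid_scheme"
    and \<theta> :: "'a list \<Rightarrow> 'm"
    and \<rho> :: "('m \<times> 'm) set"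
    and \<Gamma> :: "(nat, 'a) word_graph"
  assumes finite_alphabet: "finite A"
    and relations: "R \<subseteq> lists A \<times> lists A"
    and defined_by: "monoid_defined_by A R M \<theta>"
    and right_cong: "right_congruence M \<rho>"
    and graph_of: "word_graph_of A R \<theta> \<rho> \<Gamma>"
begin

lemma over: "word_graph_over A \<Gamma>"
  and complete: "complete_graph A \<Gamma>"
  and deterministic: "deterministic_graph A \<Gamma>"
  and compatible: "compatible_graph R \<Gamma>"
  and rho_eq: "\<rho> = map_prod \<theta> \<theta> ` path_relation \<Gamma> 0"
  using graph_of unfolding word_graph_of_def standard_graph_def by blast+

lemma theta_append: "u \<in> lists A \<Longrightarrow> v \<in> lists A \<Longrightarrow> \<theta> (u @ v) = \<theta> u \<otimes>\<^bsub>M\<^esub> \<theta> v"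
  using defined_by unfolding monoid_defined_by_def hom_def free_monoid_def by simp

lemma theta_image: "\<theta> ` lists A = carrier M"
  using defined_by unfolding monoid_defined_by_def by simp

lemma rho_refl: "x \<in> carrier M \<Longrightarrow> (x, x) \<in> \<rho>"
  using right_cong unfolding right_congruence_def equiv_def refl_on_def by blast

lemma zero_node: "0 \<in> nodes \<Gamma>"
proof -
  have "\<theta> [] \<in> carrier M" using theta_image by blast
  then obtain u \<beta> where "path \<Gamma> 0 u \<beta>"
    using rho_refl rho_eq unfolding path_relation_def by fast
  then show ?thesis using path_over(1)[OF _ over] by blast
qed

lemmas unique = path_unique[OF over deterministic]
lemmas snoc_iff = path_snoc_iff[OF over]

lemma path_from_0: "u \<in> lists A \<Longrightarrow> \<exists>\<beta>. path \<Gamma> 0 u \<beta>"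
  using path_exists[OF over complete] zero_node by blast

lemma carrier_path:
  assumes "x \<in> carrier M"
  obtains u \<beta> where "x = \<theta> u" and "path \<Gamma> 0 u \<beta>"
  using assms theta_image path_from_0 by blast

lemma path_to_theta_carrier: "path \<Gamma> 0 u \<beta> \<Longrightarrow> \<theta> u \<in> carrier M"
  using path_over(2)[OF _ over] theta_image by blast

lemma edge_source_path:
  assumes "(\<alpha>, a, \<beta>) \<in> edges \<Gamma>"
  shows "path \<Gamma> 0 (least_word \<Gamma> \<alpha>) \<alpha>"
proof -
  have "\<alpha> \<in> nodes \<Gamma>" using assms over by (auto simp: word_graph_over_def)
  then obtain w where "path \<Gamma> 0 w \<alpha>"
    using graph_of unfolding word_graph_of_def standard_graph_def by blast
  then show ?thesis using path_least_word[OF finite_alphabet over] by blast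
qed

lemma edge_paths:
  assumes "(\<alpha>, a, \<beta>) \<in> edges \<Gamma>"
  shows "path \<Gamma> 0 (least_word \<Gamma> \<alpha> @ [a]) \<beta>" and "path \<Gamma> 0 (least_word \<Gamma> \<beta>) \<beta>"
proof -
  show *: "path \<Gamma> 0 (least_word \<Gamma> \<alpha> @ [a]) \<beta>"
    using assms edge_source_path by (auto simp: snoc_iff)
  show "path \<Gamma> 0 (least_word \<Gamma> \<beta>) \<beta>"
    using path_least_word[OF finite_alphabet over *] .
qed

text \<open>
  The pairs of words that act in the same way on all the nodes form a two-sided congruence. By
  compatibility it contains \<open>R\<close>, and so it contains the kernel \<open>R\<^sup>#\<close> of \<open>\<theta>\<close>.
\<close>

lemma node_determined_by_theta:
  assumes u: "u \<in> lists A" and v: "v \<in> lists A" and "\<theta> u = \<theta> v"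
  shows "path \<Gamma> \<alpha> u \<beta> \<longleftrightarrow> path \<Gamma> \<alpha> v \<beta>"
proof -
  define \<sigma> where
    "\<sigma> = {(u, v) \<in> lists A \<times> lists A. \<forall>\<alpha> \<beta>. path \<Gamma> \<alpha> u \<beta> \<longleftrightarrow> path \<Gamma> \<alpha> v \<beta>}"
  have "equiv (lists A) \<sigma>"
    unfolding \<sigma>_def by (intro equivI refl_onI symI transI) auto
  then have cong: "two_sided_congruence (free_monoid A) \<sigma>"
    unfolding two_sided_congruence_def left_congruence_def right_congruence_def free_monoid_def
    by (auto simp: \<sigma>_def path_append_iff[OF over])
  have "(x, y) \<in> \<sigma>" if xy: "(x, y) \<in> R" for x y
  proof -
    have in_lists: "x \<in> lists A" "y \<in> lists A" using xy relations by auto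
    have "path \<Gamma> \<alpha> x \<beta> \<longleftrightarrow> path \<Gamma> \<alpha> y \<beta>" for \<alpha> \<beta>
    proof (cases "\<alpha> \<in> nodes \<Gamma>")
      case True
      with in_lists obtain \<gamma> \<delta> where "path \<Gamma> \<alpha> x \<gamma>" "path \<Gamma> \<alpha> y \<delta>"
        using path_exists[OF over complete] by metis
      moreover from this have "\<gamma> = \<delta>"
        using compatible xy True unfolding compatible_graph_def by blast
      ultimately show ?thesis using unique by metis
    next
      case False
      then show ?thesis using path_over(1)[OF _ over] by blast
    qed
    then show ?thesis using in_lists by (simp add: \<sigma>_def)
  qed
  then have "presentation_congruence A R \<subseteq> \<sigma>"
    using cong unfolding presentation_congruence_def by auto
  moreover have "(u, v) \<in> presentation_congruence A R"
    using assms defined_by unfolding monoid_defined_by_def by blast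
  ultimately show ?thesis by (auto simp: \<sigma>_def)
qed

lemma related_iff_same_node:
  assumes u: "path \<Gamma> 0 u \<alpha>" and v: "path \<Gamma> 0 v \<beta>"
  shows "(\<theta> u, \<theta> v) \<in> \<rho> \<longleftrightarrow> \<alpha> = \<beta>"
proof
  assume "(\<theta> u, \<theta> v) \<in> \<rho>"
  then obtain u' v' \<gamma> where "\<theta> u = \<theta> u'" "\<theta> v = \<theta> v'" "path \<Gamma> 0 u' \<gamma>" "path \<Gamma> 0 v' \<gamma>"
    unfolding rho_eq path_relation_def by auto
  then have "path \<Gamma> 0 u \<gamma>" "path \<Gamma> 0 v \<gamma>"
    using node_determined_by_theta path_over(2)[OF _ over] u v by metis+
  then show "\<alpha> = \<beta>" using unique u v by metis
next
  assume "\<alpha> = \<beta>"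
  then have "(u, v) \<in> path_relation \<Gamma> 0" using u v unfolding path_relation_def by blast
  then show "(\<theta> u, \<theta> v) \<in> \<rho>" unfolding rho_eq by force
qed

section \<open>Recognising singleton classes on edges\<close>

text \<open>
  Along an edge \<open>(\<alpha>, a, \<beta>)\<close> the word \<open>w\<^sub>\<alpha>\<close> may replace, up to \<open>\<theta>\<close>, any word leading to \<open>\<alpha>\<close>
  whose value is already known to be \<open>\<theta> w\<^sub>\<alpha>\<close>. The induction starts because \<open>w\<^sub>0\<close> is empty,
  and it stays inside \<open>S\<close> because \<open>S\<close> is closed under predecessors.
\<close>

lemma class_is_singleton:
  assumes pred: "\<And>\<alpha> a \<beta>. (\<alpha>, a, \<beta>) \<in> edges \<Gamma> \<Longrightarrow> \<beta> \<in> S \<Longrightarrow> \<alpha> \<in> S"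
    and edge: "\<And>\<alpha> a \<beta>. (\<alpha>, a, \<beta>) \<in> edges \<Gamma> \<Longrightarrow> \<beta> \<in> S \<Longrightarrow>
      \<theta> (least_word \<Gamma> \<alpha> @ [a]) = \<theta> (least_word \<Gamma> \<beta>)"
    and "path \<Gamma> 0 u \<beta>" and "\<beta> \<in> S"
  shows "\<theta> u = \<theta> (least_word \<Gamma> \<beta>)"
  using assms(3,4)
proof (induction u arbitrary: \<beta> rule: rev_induct)
  case Nil
  then show ?case using least_word_0[OF zero_node] by (simp add: path_Nil_iff)
next
  case (snoc a u)
  then obtain \<alpha> where \<alpha>: "path \<Gamma> 0 u \<alpha>" "(\<alpha>, a, \<beta>) \<in> edges \<Gamma>" by (auto simp: snoc_iff)
  have lists: "u \<in> lists A" "least_word \<Gamma> \<alpha> \<in> lists A" "[a] \<in> lists A"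
    using path_over(2)[OF \<alpha>(1) over] path_over(2)[OF edge_source_path[OF \<alpha>(2)] over]
      path_over(2)[OF snoc.prems(1) over]
    by auto
  have "\<theta> (u @ [a]) = \<theta> u \<otimes>\<^bsub>M\<^esub> \<theta> [a]" using lists theta_append by blast
  also have "\<theta> u = \<theta> (least_word \<Gamma> \<alpha>)" using snoc.IH \<alpha> pred snoc.prems(2) by blast
  also have "\<dots> \<otimes>\<^bsub>M\<^esub> \<theta> [a] = \<theta> (least_word \<Gamma> \<alpha> @ [a])" using lists theta_append by simp
  also have "\<dots> = \<theta> (least_word \<Gamma> \<beta>)" using edge \<alpha>(2) snoc.prems(2) by blast
  finally show ?case .
qed

lemma trivial_if_all_edges:
  assumes "\<And>\<alpha> a \<beta>. (\<alpha>, a, \<beta>) \<in> edges \<Gamma> \<Longrightarrow>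
      \<theta> (least_word \<Gamma> \<alpha> @ [a]) = \<theta> (least_word \<Gamma> \<beta>)"
  shows "\<rho> = Id_on (carrier M)"
proof
  have "\<theta> u = \<theta> (least_word \<Gamma> \<beta>)" if "path \<Gamma> 0 u \<beta>" for u \<beta>
    using class_is_singleton[of UNIV] assms that by blast
  then show "\<rho> \<subseteq> Id_on (carrier M)"
    unfolding rho_eq path_relation_def using path_to_theta_carrier by fastforce
  show "Id_on (carrier M) \<subseteq> \<rho>" using rho_refl by auto
qed

section \<open>Right Rees congruences and sinks\<close>

text \<open>
  The sink \<open>\<omega>\<close> is the node to which the words with value in \<open>I\<close> lead; letters fix it because
  \<open>I\<close> is a right ideal. At any other node \<open>\<beta>\<close> the values lie outside \<open>I\<close>, where \<open>\<rho>\<close> is equality,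
  so if \<open>\<omega>\<close> were trivial then every edge would satisfy the equation and \<open>\<rho>\<close> would be trivial.
\<close>

lemma Rees_imp_sink:
  assumes I: "right_ideal M I" and rho: "\<rho> = right_Rees_congruence M I"
    and nontriv: "\<rho> \<noteq> Id_on (carrier M)"
  shows "\<exists>\<omega>. nontrivial_sink A \<theta> \<Gamma> \<omega> \<and>
    (\<forall>\<alpha> a \<beta>. (\<alpha>, a, \<beta>) \<in> edges \<Gamma> \<and> \<beta> \<noteq> \<omega> \<longrightarrow>
       \<theta> (least_word \<Gamma> \<alpha> @ [a]) = \<theta> (least_word \<Gamma> \<beta>))"
proof -
  have "I \<noteq> {}"
    using nontriv rho by (auto simp: right_Rees_congruence_def Id_on_def)
  then obtain x where x: "x \<in> I" by blast
  then have "x \<in> carrier M" using I by (auto simp: right_ideal_def)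
  then obtain u0 \<omega> where u0: "x = \<theta> u0" "path \<Gamma> 0 u0 \<omega>" by (rule carrier_path)
  have ideal_node: "\<beta> = \<omega>" if "\<theta> u \<in> I" "path \<Gamma> 0 u \<beta>" for u \<beta>
  proof -
    have "(\<theta> u, \<theta> u0) \<in> \<rho>"
      using that x u0 path_to_theta_carrier rho by (auto simp: right_Rees_congruence_def)
    then show ?thesis using related_iff_same_node that(2) u0(2) by blast
  qed
  have "(\<omega>, a, \<omega>) \<in> edges \<Gamma>" if a: "a \<in> A" for a
  proof -
    have u0_A: "u0 \<in> lists A" using path_over(2)[OF u0(2) over] .
    with a obtain \<beta> where \<beta>: "path \<Gamma> 0 (u0 @ [a]) \<beta>" using path_from_0[of "u0 @ [a]"] by auto
    have "\<theta> (u0 @ [a]) = \<theta> u0 \<otimes>\<^bsub>M\<^esub> \<theta> [a]" using u0_A a theta_append by simp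
    moreover have "\<theta> [a] \<in> carrier M" using theta_image a by auto
    ultimately have "\<theta> (u0 @ [a]) \<in> I" using I x u0(1) by (simp add: right_ideal_def)
    then have "\<beta> = \<omega>" using ideal_node \<beta> by blast
    then show ?thesis using \<beta> unique u0(2) by (auto simp: snoc_iff)
  qed
  then have sink: "sink A \<Gamma> \<omega>" using path_over(3)[OF u0(2) over] by (simp add: sink_def)
  have eq: "\<theta> (least_word \<Gamma> \<alpha> @ [a]) = \<theta> (least_word \<Gamma> \<beta>)"
    if e: "(\<alpha>, a, \<beta>) \<in> edges \<Gamma>" and "\<beta> \<noteq> \<omega>" for \<alpha> a \<beta>
  proof -
    note p = edge_paths[OF e]
    have "(\<theta> (least_word \<Gamma> \<alpha> @ [a]), \<theta> (least_word \<Gamma> \<beta>)) \<in> \<rho>"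
      using related_iff_same_node[OF p] by simp
    moreover have "\<theta> (least_word \<Gamma> \<beta>) \<notin> I" using ideal_node p(2) \<open>\<beta> \<noteq> \<omega>\<close> by blast
    ultimately show ?thesis using rho by (auto simp: right_Rees_congruence_def)
  qed
  have "nontrivial_sink A \<theta> \<Gamma> \<omega>"
  proof (rule ccontr)
    assume "\<not> nontrivial_sink A \<theta> \<Gamma> \<omega>"
    then have "\<rho> = Id_on (carrier M)"
      using trivial_if_all_edges eq sink unfolding nontrivial_sink_def by metis
    then show False using nontriv by simp
  qed
  then show ?thesis using eq by blast
qed

text \<open>
  The right ideal is the class \<open>\<omega>\<close>. No predecessor of a node other than \<open>\<omega>\<close> is \<open>\<omega>\<close>, because
  \<open>\<omega>\<close> is a sink; so \<open>class_is_singleton\<close> applies to the complement of \<open>{\<omega>}\<close>.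
\<close>

lemma sink_imp_Rees:
  assumes \<omega>: "nontrivial_sink A \<theta> \<Gamma> \<omega>"
    and edge: "\<And>\<alpha> a \<beta>. (\<alpha>, a, \<beta>) \<in> edges \<Gamma> \<Longrightarrow> \<beta> \<noteq> \<omega> \<Longrightarrow>
      \<theta> (least_word \<Gamma> \<alpha> @ [a]) = \<theta> (least_word \<Gamma> \<beta>)"
  shows "nontrivial_right_Rees_congruence M \<rho>"
proof -
  have sink: "sink A \<Gamma> \<omega>" using \<omega> by (simp add: nontrivial_sink_def)
  note stay = path_from_sink[OF over deterministic sink]
  have pred: "\<alpha> \<noteq> \<omega>" if e: "(\<alpha>, a, \<beta>) \<in> edges \<Gamma>" and "\<beta> \<noteq> \<omega>" for \<alpha> a \<beta>
  proof
    assume "\<alpha> = \<omega>"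
    moreover have "\<beta> \<in> nodes \<Gamma>" using e over by (auto simp: word_graph_over_def)
    ultimately have "path \<Gamma> \<omega> [a] \<beta>" using e by (simp add: path_Cons_iff path_Nil_iff)
    then show False using stay \<open>\<beta> \<noteq> \<omega>\<close> by blast
  qed
  have single: "\<theta> u = \<theta> (least_word \<Gamma> \<beta>)" if "path \<Gamma> 0 u \<beta>" "\<beta> \<noteq> \<omega>" for u \<beta>
    using class_is_singleton[of "- {\<omega>}"] pred edge that by simp
  define I where "I = {\<theta> u |u. path \<Gamma> 0 u \<omega>}"
  have "right_ideal M I"
    unfolding right_ideal_def
  proof (intro conjI ballI)
    show "I \<subseteq> carrier M" using path_to_theta_carrier by (auto simp: I_def)
  next
    fix x s assume "x \<in> I" and "s \<in> carrier M"
    then obtain u v where uv: "x = \<theta> u" "path \<Gamma> 0 u \<omega>" "s = \<theta> v" "v \<in> lists A"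
      using theta_image unfolding I_def by blast
    have lists: "u \<in> lists A" "u @ v \<in> lists A"
      using path_over(2)[OF uv(2) over] uv(4) by simp_all
    then obtain \<beta> where \<beta>: "path \<Gamma> 0 (u @ v) \<beta>" using path_from_0 by blast
    then have "\<beta> = \<omega>" using uv(2) stay unique unfolding path_append_iff[OF over] by blast
    then have "\<theta> (u @ v) \<in> I" using \<beta> unfolding I_def by blast
    then show "x \<otimes>\<^bsub>M\<^esub> s \<in> I" using uv(1,3,4) lists(1) theta_append by simp
  qed
  moreover have "\<rho> = right_Rees_congruence M I"
  proof (intro subset_antisym subrelI)
    fix x y assume "(x, y) \<in> \<rho>"
    then obtain u v \<beta> where uv: "x = \<theta> u" "y = \<theta> v" "path \<Gamma> 0 u \<beta>" "path \<Gamma> 0 v \<beta>"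
      unfolding rho_eq path_relation_def by auto
    have "x = y \<or> x \<in> I \<and> y \<in> I"
    proof (cases "\<beta> = \<omega>")
      case True
      then show ?thesis using uv by (auto simp: I_def)
    next
      case False
      then show ?thesis using uv single by simp
    qed
    then show "(x, y) \<in> right_Rees_congruence M I"
      using uv path_to_theta_carrier by (simp add: right_Rees_congruence_def)
  next
    fix x y assume "(x, y) \<in> right_Rees_congruence M I"
    then show "(x, y) \<in> \<rho>"
      using rho_refl related_iff_same_node by (auto simp: right_Rees_congruence_def I_def)
  qed
  moreover have "\<rho> \<noteq> Id_on (carrier M)"
  proof -
    obtain \<alpha> a where e: "(\<alpha>, a, \<omega>) \<in> edges \<Gamma>"
      and ne: "\<theta> (least_word \<Gamma> \<alpha> @ [a]) \<noteq> \<theta> (least_word \<Gamma> \<omega>)"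
      using \<omega> by (auto simp: nontrivial_sink_def)
    have "(\<theta> (least_word \<Gamma> \<alpha> @ [a]), \<theta> (least_word \<Gamma> \<omega>)) \<in> \<rho>"
      using related_iff_same_node[OF edge_paths[OF e]] by simp
    then show ?thesis using ne by auto
  qed
  ultimately show ?thesis unfolding nontrivial_right_Rees_congruence_def by blast
qed

end

theorem theorem5p6:
  fixes A :: "'a::linorder set"
    and R :: "('a list \<times> 'a list) set"
    and M :: "('m, 'z) monoid_scheme"
    and \<theta> :: "'a list \<Rightarrow> 'm"
    and \<rho> :: "('m \<times> 'm) set"
    and \<Gamma> :: "(nat, 'a) word_graph"
  assumes "finite A"
    and "R \<subseteq> lists A \<times> lists A"
    and "monoid_defined_by A R M \<theta>"
    and "right_congruence M \<rho>"
    and "word_graph_of A R \<theta> \<rho> \<Gamma>"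
  shows "nontrivial_right_Rees_congruence M \<rho> \<longleftrightarrow>
    (\<exists>\<omega>. (nontrivial_sink A \<theta> \<Gamma> \<omega> \<and> (\<forall>\<omega>'. nontrivial_sink A \<theta> \<Gamma> \<omega>' \<longrightarrow> \<omega>' = \<omega>)) \<and>
         (\<forall>\<alpha> a \<beta>. (\<alpha>, a, \<beta>) \<in> edges \<Gamma> \<and> \<beta> \<noteq> \<omega> \<longrightarrow>
            \<theta> (least_word \<Gamma> \<alpha> @ [a]) = \<theta> (least_word \<Gamma> \<beta>)))"
proof -
  interpret right_congruence_word_graph A R M \<theta> \<rho> \<Gamma>
    using assms by unfold_locales
  show ?thesis
  proof
    assume "nontrivial_right_Rees_congruence M \<rho>"
    then obtain \<omega> where \<omega>: "nontrivial_sink A \<theta> \<Gamma> \<omega>"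
      and edge: "\<forall>\<alpha> a \<beta>. (\<alpha>, a, \<beta>) \<in> edges \<Gamma> \<and> \<beta> \<noteq> \<omega> \<longrightarrow>
        \<theta> (least_word \<Gamma> \<alpha> @ [a]) = \<theta> (least_word \<Gamma> \<beta>)"
      using Rees_imp_sink unfolding nontrivial_right_Rees_congruence_def by blast
    \<comment> \<open>The edge that makes another sink non-trivial would contradict \<open>edge\<close>.\<close>
    have "\<forall>\<omega>'. nontrivial_sink A \<theta> \<Gamma> \<omega>' \<longrightarrow> \<omega>' = \<omega>"
      using edge unfolding nontrivial_sink_def by metis
    then show "\<exists>\<omega>. (nontrivial_sink A \<theta> \<Gamma> \<omega> \<and>
        (\<forall>\<omega>'. nontrivial_sink A \<theta> \<Gamma> \<omega>' \<longrightarrow> \<omega>' = \<omega>)) \<and>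
        (\<forall>\<alpha> a \<beta>. (\<alpha>, a, \<beta>) \<in> edges \<Gamma> \<and> \<beta> \<noteq> \<omega> \<longrightarrow>
          \<theta> (least_word \<Gamma> \<alpha> @ [a]) = \<theta> (least_word \<Gamma> \<beta>))"
      using \<omega> edge by blast
  next
    assume "\<exists>\<omega>. (nontrivial_sink A \<theta> \<Gamma> \<omega> \<and>
        (\<forall>\<omega>'. nontrivial_sink A \<theta> \<Gamma> \<omega>' \<longrightarrow> \<omega>' = \<omega>)) \<and>
        (\<forall>\<alpha> a \<beta>. (\<alpha>, a, \<beta>) \<in> edges \<Gamma> \<and> \<beta> \<noteq> \<omega> \<longrightarrow>
          \<theta> (least_word \<Gamma> \<alpha> @ [a]) = \<theta> (least_word \<Gamma> \<beta>))"
    then show "nontrivial_right_Rees_congruence M \<rho>"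
      using sink_imp_Rees by blast
  qed
qed

end
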